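(* Let $(a_0(n))_n$ and $(a_1(n))_n$ be real sequences with $2a_0(n)+a_1(n)=1$ for all $n$, and let $B_n^{M,1}$ be the associated modified Bernstein operators. Suppose $f\in C^2[0,1]$, $x\in[0,1]$, and that the (finite) limit $L_1:=\lim_{n\to\infty}a_1(n)$ exists. Then $$\lim_{n\to\infty} n\left[B_n^{M,1}(f;x)-f(x)\right]=\frac{x(1-x)}{2}f''(x)+\frac{1-2x}{2}(1+L_1)f'(x).$$
   Context: Bernstein basis: $p_{n,k}(x)=\binom nk x^k(1-x)^{n-k}$ for $0\le k\le n$, $x\in[0,1]$ (with $0^0=1$), and $p_{n,k}=0$ if $k<0$ or $k>n$. Modified basis: given real sequences $a_0(n),a_1(n)$, put $a(x,n)=a_1(n)x+a_0(n)$ and, for $0\le k\le n$, $$p_{n,k}^{M,1}(x)=a(x,n)\,p_{n-1,k}(x)+a(1-x,n)\,p_{n-1,k-1}(x).$$ Modified Bernstein operator: $B_n^{M,1}(f;x)=\sum_{k=0}^n p_{n,k}^{M,1}(x)f(k/n)$, $n\ge1$. (No positivity is assumed.) *)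

theory Defs
  imports "HOL-Analysis.Analysis"
begin

text \<open>
  The library's \<^const>\<open>Bernstein\<close> takes a natural index and already vanishes for \<open>k > n\<close>;
  the integer index adds the convention that it is zero for \<open>k < 0\<close>.
\<close>

definition bernstein_basis :: "nat \<Rightarrow> int \<Rightarrow> real \<Rightarrow> real" where
  "bernstein_basis n k x = (if k < 0 then 0 else Bernstein n (nat k) x)"

definition mod_coeff :: "(nat \<Rightarrow> real) \<Rightarrow> (nat \<Rightarrow> real) \<Rightarrow> real \<Rightarrow> nat \<Rightarrow> real" where
  "mod_coeff a0 a1 x n = a1 n * x + a0 n"

text \<open>
  The modified basis and operator are meant for \<open>n \<ge> 1\<close> only; at \<open>n = 0\<close> the truncated
  subtraction \<open>n - 1\<close> gives an irrelevant value.
\<close>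

definition mod_bernstein_basis ::
  "(nat \<Rightarrow> real) \<Rightarrow> (nat \<Rightarrow> real) \<Rightarrow> nat \<Rightarrow> nat \<Rightarrow> real \<Rightarrow> real" where
  "mod_bernstein_basis a0 a1 n k x =
     mod_coeff a0 a1 x n * bernstein_basis (n - 1) (int k) x
     + mod_coeff a0 a1 (1 - x) n * bernstein_basis (n - 1) (int k - 1) x"

definition mod_bernstein_op ::
  "(nat \<Rightarrow> real) \<Rightarrow> (nat \<Rightarrow> real) \<Rightarrow> nat \<Rightarrow> (real \<Rightarrow> real) \<Rightarrow> real \<Rightarrow> real" where
  "mod_bernstein_op a0 a1 n f x =
     (\<Sum>k\<le>n. mod_bernstein_basis a0 a1 n k x * f (real k / real n))"

end

(* The modified operator of degree n = m + 1 splits as a(x,n) E f(k/n) + a(1-x,n) E f((k+1)/n), where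
   E is the mean of k under the binomial distribution with parameters m and x, and the two weights
   have sum 1. Expand f at x to second order. The first two moments of k - m x give the
   limit. As the weights may be negative, the Peano remainder is bounded in absolute value: it is at most
   e (t - x)^2 + K (t - x)^4 for every e > 0 and a suitable K, and the moments of order two and
   four are O(1/n) and O(1/n^2). *)

theory Submission
  imports Defs
begin

section \<open>Means under the binomial weights\<close>

definition bernstein_mean :: "nat \<Rightarrow> real \<Rightarrow> (nat \<Rightarrow> real) \<Rightarrow> real" where
  "bernstein_mean m x g = (\<Sum>k\<le>m. Bernstein m k x * g k)"

lemma bernstein_mean_add:
  "bernstein_mean m x (\<lambda>k. g k + h k) = bernstein_mean m x g + bernstein_mean m x h"
  by (simp add: bernstein_mean_def sum.distrib algebra_simps)

lemma bernstein_mean_cmult: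
  "bernstein_mean m x (\<lambda>k. c * g k) = c * bernstein_mean m x g"
  by (simp add: bernstein_mean_def sum_distrib_left algebra_simps)

lemma bernstein_mean_const: "bernstein_mean m x (\<lambda>k. c) = c"
  by (simp add: bernstein_mean_def flip: sum_distrib_right)

lemma bernstein_mean_mono:
  assumes "x \<in> {0..1}" "\<And>k. k \<le> m \<Longrightarrow> g k \<le> h k"
  shows "bernstein_mean m x g \<le> bernstein_mean m x h"
  unfolding bernstein_mean_def
  by (intro sum_mono mult_left_mono) (use assms in \<open>auto intro: Bernstein_nonneg\<close>)

lemma abs_bernstein_mean_le:
  assumes "x \<in> {0..1}"
  shows "\<bar>bernstein_mean m x g\<bar> \<le> bernstein_mean m x (\<lambda>k. \<bar>g k\<bar>)"
proof -
  have "\<bar>bernstein_mean m x g\<bar> \<le> (\<Sum>k\<le>m. \<bar>Bernstein m k x * g k\<bar>)"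
    unfolding bernstein_mean_def by (rule sum_abs)
  also have "\<dots> = bernstein_mean m x (\<lambda>k. \<bar>g k\<bar>)"
    unfolding bernstein_mean_def
    by (intro sum.cong) (use assms in \<open>auto simp: abs_mult Bernstein_nonneg\<close>)
  finally show ?thesis .
qed

section \<open>Recursion in the degree and splitting of the modified operator\<close>

lemma Bernstein_Suc_Suc:
  "Bernstein (Suc m) (Suc k) x = x * Bernstein m k x + (1 - x) * Bernstein m (Suc k) x"
\<comment> \<open>This is Pascal's rule. The factor \<open>1 - x\<close> merges with
  \<open>(1 - x) ^ (m - Suc k)\<close> only for \<open>k < m\<close>, because subtraction truncates;
  otherwise \<open>m choose Suc k\<close> is zero.\<close>
proof (cases "k < m")
  case True
  then have "m - k = Suc (m - Suc k)" by simp
  then show ?thesis by (simp add: Bernstein_def algebra_simps)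
next
  case False
  then show ?thesis by (simp add: Bernstein_def binomial_eq_0 algebra_simps)
qed

text \<open>Conditioning on one of \<open>Suc m\<close> trials: a failure leaves the count alone,
  and a success, of weight \<open>x\<close>, raises it by one. The inductions for the moments run on
  this recursion.\<close>

lemma bernstein_mean_Suc:
  "bernstein_mean (Suc m) x g =
     (1 - x) * bernstein_mean m x g + x * bernstein_mean m x (\<lambda>k. g (Suc k))"
proof -
  \<comment> \<open>The added term at \<open>Suc m\<close> vanishes. With this upper limit both
    means split off the index 0 in the same way.\<close>
  have "bernstein_mean m x g = (\<Sum>k\<le>Suc m. Bernstein m k x * g k)"
    by (simp add: bernstein_mean_def Bernstein_def)
  also have "\<dots> = Bernstein m 0 x * g 0 + (\<Sum>k\<le>m. Bernstein m (Suc k) x * g (Suc k))"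
    by (rule sum.atMost_Suc_shift)
  finally have eq: "bernstein_mean m x g = \<dots>" .
  have "bernstein_mean (Suc m) x g =
      Bernstein (Suc m) 0 x * g 0 + (\<Sum>k\<le>m. Bernstein (Suc m) (Suc k) x * g (Suc k))"
    unfolding bernstein_mean_def by (rule sum.atMost_Suc_shift)
  also have "Bernstein (Suc m) 0 x = (1 - x) * Bernstein m 0 x"
    by (simp add: Bernstein_def)
  also have "(\<Sum>k\<le>m. Bernstein (Suc m) (Suc k) x * g (Suc k)) =
      (\<Sum>k\<le>m. x * (Bernstein m k x * g (Suc k)) + (1 - x) * (Bernstein m (Suc k) x * g (Suc k)))"
    by (simp only: Bernstein_Suc_Suc distrib_right mult.assoc)
  also have "\<dots> =
      x * bernstein_mean m x (\<lambda>k. g (Suc k)) +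
      (1 - x) * (\<Sum>k\<le>m. Bernstein m (Suc k) x * g (Suc k))"
    by (simp only: bernstein_mean_def sum.distrib sum_distrib_left)
  finally show ?thesis
    by (simp add: eq algebra_simps)
qed

text \<open>Degree \<open>Suc m\<close> turns \<open>n - 1\<close> into \<open>m\<close>. In the
  first half the top summand vanishes since its index exceeds \<open>m\<close>; in the second half
  the summand at 0 vanishes by the convention for negative indices, and the index shift moves the
  nodes to \<open>Suc k / Suc m\<close>.\<close>

lemma mod_bernstein_op_Suc:
  "mod_bernstein_op a0 a1 (Suc m) f x =
     mod_coeff a0 a1 x (Suc m) * bernstein_mean m x (\<lambda>k. f (real k / real (Suc m))) +
     mod_coeff a0 a1 (1 - x) (Suc m) * bernstein_mean m x (\<lambda>k. f (real (Suc k) / real (Suc m)))"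
proof -
  have "(\<Sum>k\<le>Suc m. bernstein_basis m (int k) x * f (real k / real (Suc m))) =
      bernstein_mean m x (\<lambda>k. f (real k / real (Suc m)))"
    by (simp add: bernstein_basis_def bernstein_mean_def Bernstein_def)
  moreover have "(\<Sum>k\<le>Suc m. bernstein_basis m (int k - 1) x * f (real k / real (Suc m))) =
      bernstein_mean m x (\<lambda>k. f (real (Suc k) / real (Suc m)))"
    by (subst sum.atMost_Suc_shift) (simp add: bernstein_basis_def bernstein_mean_def)
  ultimately show ?thesis
    unfolding mod_bernstein_op_def mod_bernstein_basis_def
    by (simp only: distrib_right sum.distrib mult.assoc sum_distrib_left[symmetric] diff_Suc_1)
qed

section \<open>Central moments\<close>

lemma bernstein_mean_central1: "bernstein_mean m x (\<lambda>k. real k - real m * x) = 0"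
proof (induction m)
  case 0
  then show ?case by (simp add: bernstein_mean_def)
next
  case (Suc m)
  define y where "y k = real k - real m * x" for k
  \<comment> \<open>The centre moves by \<open>x\<close>, so the deviation \<open>y k\<close>
    changes by \<open>-x\<close> after a failure and by \<open>1 - x\<close> after a success. These
    changes have weighted mean 0.\<close>
  have "bernstein_mean (Suc m) x (\<lambda>k. real k - real (Suc m) * x) =
      (1 - x) * bernstein_mean m x (\<lambda>k. y k + (-x)) + x * bernstein_mean m x (\<lambda>k. y k + (1 - x))"
    unfolding bernstein_mean_Suc by (simp add: y_def algebra_simps)
  then show ?case
    using Suc.IH unfolding bernstein_mean_add bernstein_mean_const y_def[symmetric]
    by (simp add: algebra_simps)
qed

text \<open>The cross term has mean 0 by the first moment. The shift serves the induction for the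
  variance and, later, the offset of the nodes from the binomial centre.\<close>

lemma bernstein_mean_shift2:
  "bernstein_mean m x (\<lambda>k. (real k - real m * x + c)\<^sup>2) =
     bernstein_mean m x (\<lambda>k. (real k - real m * x)\<^sup>2) + c\<^sup>2"
proof -
  have "(\<lambda>k. (real k - real m * x + c)\<^sup>2) =
      (\<lambda>k. (real k - real m * x)\<^sup>2 + (2 * c * (real k - real m * x) + c\<^sup>2))"
    by (simp add: power2_eq_square algebra_simps)
  then show ?thesis
    by (simp only: bernstein_mean_add bernstein_mean_cmult bernstein_mean_const
        bernstein_mean_central1)
qed

lemma bernstein_mean_central2:
  "bernstein_mean m x (\<lambda>k. (real k - real m * x)\<^sup>2) = real m * (x * (1 - x))"
proof (induction m)
  case 0
  then show ?case by (simp add: bernstein_mean_def)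
next
  case (Suc m)
  define y where "y k = real k - real m * x" for k
  have "bernstein_mean (Suc m) x (\<lambda>k. (real k - real (Suc m) * x)\<^sup>2) =
      (1 - x) * bernstein_mean m x (\<lambda>k. (y k + (-x))\<^sup>2) +
      x * bernstein_mean m x (\<lambda>k. (y k + (1 - x))\<^sup>2)"
    unfolding bernstein_mean_Suc by (simp add: y_def algebra_simps)
  \<comment> \<open>Each trial adds (1 - x) x^2 + x (1 - x)^2 = x (1 - x) to the variance.\<close>
  then show ?case
    unfolding y_def bernstein_mean_shift2 Suc.IH
    by (simp add: algebra_simps power2_eq_square)
qed

lemma bernstein_mean_central4:
  "bernstein_mean m x (\<lambda>k. (real k - real m * x) ^ 4) =
     3 * (x * (1 - x))\<^sup>2 * (real m)\<^sup>2 + x * (1 - x) * (1 - 6 * (x * (1 - x))) * real m"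
proof (induction m)
  case 0
  then show ?case by (simp add: bernstein_mean_def)
next
  case (Suc m)
  define y where "y k = real k - real m * x" for k
  define q where "q = x * (1 - x)"
  have "bernstein_mean (Suc m) x (\<lambda>k. (real k - real (Suc m) * x) ^ 4) =
      (1 - x) * bernstein_mean m x (\<lambda>k. (y k - x) ^ 4) +
      x * bernstein_mean m x (\<lambda>k. (y k + (1 - x)) ^ 4)"
    unfolding bernstein_mean_Suc by (simp add: y_def algebra_simps)
  also have "\<dots> = bernstein_mean m x (\<lambda>k. (1 - x) * (y k - x) ^ 4 + x * (y k + (1 - x)) ^ 4)"
    by (simp only: bernstein_mean_add bernstein_mean_cmult)
  \<comment> \<open>The cubic terms cancel because the shifts \<open>-x\<close> and
    \<open>1 - x\<close> have weighted mean 0, so no third moment enters; the linear term will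
    vanish by the first moment.\<close>
  also have "(\<lambda>k. (1 - x) * (y k - x) ^ 4 + x * (y k + (1 - x)) ^ 4) =
      (\<lambda>k. y k ^ 4 + (6 * q * (y k)\<^sup>2 + (4 * (x * (1 - x) ^ 3 - (1 - x) * x ^ 3) * y k + (q - 3 * q\<^sup>2))))"
    unfolding q_def by (rule ext) algebra
  also have "bernstein_mean m x \<dots> =
      3 * q\<^sup>2 * (real m)\<^sup>2 + q * (1 - 6 * q) * real m + (6 * q * (real m * q) + (q - 3 * q\<^sup>2))"
    unfolding bernstein_mean_add bernstein_mean_cmult bernstein_mean_const
    unfolding y_def bernstein_mean_central1 bernstein_mean_central2 Suc.IH by (simp add: q_def)
  also have "\<dots> = 3 * q\<^sup>2 * (real (Suc m))\<^sup>2 + q * (1 - 6 * q) * real (Suc m)"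
    by (simp add: power2_eq_square algebra_simps)
  finally show ?case by (simp add: q_def)
qed

section \<open>Bounds for the fourth moment and for the Taylor remainder\<close>

lemma power4_add_le: "(u + v) ^ 4 \<le> 8 * (u ^ 4 + v ^ 4)" for u v :: real
proof -
  \<comment> \<open>Used for \<open>u\<close>, \<open>v\<close> and again for their squares, this
    inequality gives the constant 2^2 * 2 = 8.\<close>
  have "(u + v)\<^sup>2 \<le> 2 * (u\<^sup>2 + v\<^sup>2)"
    using zero_le_power2[of "u - v"] by (simp add: power2_eq_square algebra_simps)
  then have "((u + v)\<^sup>2)\<^sup>2 \<le> (2 * (u\<^sup>2 + v\<^sup>2))\<^sup>2"
    by (rule power_mono) simp
  also have "\<dots> \<le> 8 * ((u\<^sup>2)\<^sup>2 + (v\<^sup>2)\<^sup>2)"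
    using zero_le_power2[of "u\<^sup>2 - v\<^sup>2"] by (simp add: power2_eq_square algebra_simps)
  finally show ?thesis by (simp flip: power_mult)
qed

text \<open>Only the order m^2 matters, so the explicit fourth moment is estimated crudely: 8 (3 m^2
  + m + 1) \<le> 32 (m + 1)^2.\<close>

lemma bernstein_mean_shift4_le:
  assumes "x \<in> {0..1}" "\<bar>c\<bar> \<le> 1"
  shows "bernstein_mean m x (\<lambda>k. (real k - real m * x + c) ^ 4) \<le> 32 * (real (Suc m))\<^sup>2"
proof -
  define q where "q = x * (1 - x)"
  have q: "0 \<le> q" "q \<le> 1"
    using assms mult_mono[of x 1 "1 - x" 1] by (auto simp: q_def)
  have "bernstein_mean m x (\<lambda>k. (real k - real m * x + c) ^ 4) \<le>
      bernstein_mean m x (\<lambda>k. 8 * ((real k - real m * x) ^ 4 + c ^ 4))"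
    by (intro bernstein_mean_mono assms power4_add_le)
  also have "\<dots> = 8 * (3 * q\<^sup>2 * (real m)\<^sup>2 + q * (1 - 6 * q) * real m + c ^ 4)"
    by (simp only: bernstein_mean_cmult bernstein_mean_add bernstein_mean_const
        bernstein_mean_central4 q_def)
  also have "\<dots> \<le> 8 * (3 * 1 * (real m)\<^sup>2 + 1 * real m + 1)"
  proof -
    have "q\<^sup>2 \<le> 1" using q by (simp add: power_le_one)
    \<comment> \<open>The factor \<open>1 - 6 * q\<close> may be negative, but it is at most
      1.\<close>
    moreover have "q * (1 - 6 * q) \<le> 1 * 1"
      using q by (smt (verit) mult_left_le)
    moreover have "c ^ 4 \<le> 1"
      using power_le_one[of "\<bar>c\<bar>" 4] assms by simp
    ultimately show ?thesis
      by (intro mult_left_mono add_mono mult_right_mono) auto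
  qed
  also have "\<dots> \<le> 32 * (real (Suc m))\<^sup>2"
    by (simp add: power2_eq_square algebra_simps)
  finally show ?thesis .
qed

text \<open>Near \<open>x\<close> the remainder has derivative at most e |s - x| in absolute value,
  and the mean value inequality gives the quadratic term. Away from \<open>x\<close> it is merely
  bounded, and the quartic term absorbs it.\<close>

lemma peano_remainder:
  fixes f f' :: "real \<Rightarrow> real"
  assumes f: "\<And>t. t \<in> {0..1} \<Longrightarrow> (f has_real_derivative f' t) (at t within {0..1})"
    and f': "(f' has_real_derivative d) (at x within {0..1})"
    and x: "x \<in> {0..1}" and "e > 0"
  obtains K where "K \<ge> 0"
    "\<And>t. t \<in> {0..1} \<Longrightarrow>
       \<bar>f t - (f x + f' x * (t - x) + d / 2 * (t - x)\<^sup>2)\<bar> \<le> e * (t - x)\<^sup>2 + K * (t - x) ^ 4"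
proof -
  define R where "R t = f t - (f x + f' x * (t - x) + d / 2 * (t - x)\<^sup>2)" for t
  have R_deriv: "(R has_real_derivative f' t - (f' x + d * (t - x))) (at t within {0..1})"
    if "t \<in> {0..1}" for t
    unfolding R_def by (rule derivative_eq_intros f[OF that] refl | simp)+
  from f' \<open>e > 0\<close> obtain r where "r > 0"
    and r: "\<And>s. s \<in> {0..1} \<Longrightarrow> \<bar>s - x\<bar> < r \<Longrightarrow> \<bar>f' s - f' x - d * (s - x)\<bar> \<le> e * \<bar>s - x\<bar>"
    unfolding has_field_derivative_def has_derivative_within_alt by (auto simp: mult.commute)
  have near: "\<bar>R t\<bar> \<le> e * (t - x)\<^sup>2" if t: "t \<in> {0..1}" "\<bar>t - x\<bar> < r" for t
  proof -
    \<comment> \<open>A convex set containing \<open>x\<close> and \<open>t\<close> on which |s - x|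
      \<le> |t - x| < r, so that the derivative of \<open>R\<close> is bounded by the constant
      \<open>e * \<bar>t - x\<bar>\<close>; moreover \<open>R x = 0\<close>.\<close>
    define S where "S = {0..1} \<inter> cball x \<bar>t - x\<bar>"
    have "norm (R t - R x) \<le> (e * \<bar>t - x\<bar>) * norm (t - x)"
    proof (rule field_differentiable_bound)
      show "convex S" unfolding S_def by (intro convex_Int convex_cball) simp
      show "t \<in> S" "x \<in> S" using t x by (auto simp: S_def dist_real_def)
      fix s assume s: "s \<in> S"
      then show "(R has_real_derivative f' s - (f' x + d * (s - x))) (at s within S)"
        by (intro DERIV_subset[OF R_deriv]) (auto simp: S_def)
      have "\<bar>s - x\<bar> \<le> \<bar>t - x\<bar>" using s by (auto simp: S_def dist_real_def)
      then have "e * \<bar>s - x\<bar> \<le> e * \<bar>t - x\<bar>" using \<open>e > 0\<close> by simp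
      moreover have "\<bar>f' s - f' x - d * (s - x)\<bar> \<le> e * \<bar>s - x\<bar>"
        using r[of s] s t by (auto simp: S_def dist_real_def)
      ultimately show "norm (f' s - (f' x + d * (s - x))) \<le> e * \<bar>t - x\<bar>"
        by (simp add: algebra_simps)
    qed
    then show ?thesis by (simp add: R_def power2_eq_square mult.assoc)
  qed
  have "continuous_on {0..1} R"
    using R_deriv by (rule DERIV_continuous_on)
  then have "bounded (R ` {0..1})"
    by (intro compact_imp_bounded compact_continuous_image) auto
  then obtain M where "M > 0" and M: "\<And>t. t \<in> {0..1} \<Longrightarrow> \<bar>R t\<bar> \<le> M"
    unfolding bounded_pos by auto
  show thesis
  proof
    \<comment> \<open>This choice of \<open>K\<close> makes the quartic term at least
      \<open>M\<close> as soon as |t - x| \<ge> r.\<close>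
    show "M / r ^ 4 \<ge> 0" using \<open>M > 0\<close> by simp
    fix t :: real assume t: "t \<in> {0..1}"
    show "\<bar>f t - (f x + f' x * (t - x) + d / 2 * (t - x)\<^sup>2)\<bar> \<le> e * (t - x)\<^sup>2 + M / r ^ 4 * (t - x) ^ 4"
    proof (cases "\<bar>t - x\<bar> < r")
      case True
      moreover have "M / r ^ 4 * (t - x) ^ 4 \<ge> 0" using \<open>M > 0\<close> by simp
      ultimately show ?thesis using near[OF t] by (simp add: R_def)
    next
      case False
      then have "r ^ 4 \<le> \<bar>t - x\<bar> ^ 4" using \<open>r > 0\<close> by (intro power_mono) auto
      then have "M * r ^ 4 \<le> M * (t - x) ^ 4" using \<open>M > 0\<close> by simp
      then have "M \<le> M / r ^ 4 * (t - x) ^ 4"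
        using \<open>r > 0\<close> by (simp add: field_simps)
      moreover have "e * (t - x)\<^sup>2 \<ge> 0" using \<open>e > 0\<close> by simp
      ultimately show ?thesis using M[OF t] by (simp add: R_def)
    qed
  qed
qed

text \<open>The cases c = 0 and c = 1 are the two node families of the modified operator. After
  multiplication by \<open>n\<close>, the second moment, at most 2 n, contributes
  \<open>2 * e\<close>, and the fourth, at most 32 n^2, contributes
  \<open>32 * K / n\<close>.\<close>

lemma bernstein_mean_taylor:
  fixes f :: "real \<Rightarrow> real" and m :: nat
  assumes x: "x \<in> {0..1}" and c: "c \<in> {0..1}" and e: "e \<ge> 0" and K: "K \<ge> 0"
    and bound: "\<And>t. t \<in> {0..1} \<Longrightarrow>
      \<bar>f t - (f x + b * (t - x) + d / 2 * (t - x)\<^sup>2)\<bar> \<le> e * (t - x)\<^sup>2 + K * (t - x) ^ 4"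
  defines "n \<equiv> real (Suc m)"
  shows "\<bar>n * (bernstein_mean m x (\<lambda>k. f ((real k + c) / n)) - f x) -
      (b * (c - x) + d / 2 * ((real m * (x * (1 - x)) + (c - x)\<^sup>2) / n))\<bar> \<le> 2 * e + 32 * K / n"
proof -
  define t where "t k = (real k + c) / n" for k
  define y where "y k = real k - real m * x + (c - x)" for k
  define R where "R k = f (t k) - (f x + b * (t k - x) + d / 2 * (t k - x)\<^sup>2)" for k
  have n: "n \<ge> 1" by (simp add: n_def)
  \<comment> \<open>Since n = m + 1, the numerator k + c - n x equals (k - m x) + (c - x).\<close>
  have ty: "t k - x = y k / n" for k
    unfolding t_def y_def n_def by (simp add: field_simps)
  have t01: "t k \<in> {0..1}" if "k \<le> m" for k
    using that c by (auto simp: t_def n_def field_simps)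
  have q: "x * (1 - x) \<in> {0..1}" using x mult_mono[of x 1 "1 - x" 1] by auto
  have cx: "\<bar>c - x\<bar> \<le> 1" using x c by auto
  have y1: "bernstein_mean m x y = c - x"
    unfolding y_def bernstein_mean_add bernstein_mean_const bernstein_mean_central1 by simp
  have y2: "bernstein_mean m x (\<lambda>k. (y k)\<^sup>2) = real m * (x * (1 - x)) + (c - x)\<^sup>2"
    unfolding y_def bernstein_mean_shift2 bernstein_mean_central2 by simp
  have y2_le: "bernstein_mean m x (\<lambda>k. (y k)\<^sup>2) \<le> 2 * n"
  proof -
    have "real m * (x * (1 - x)) \<le> real m * 1" using q by (intro mult_left_mono) auto
    moreover have "(c - x)\<^sup>2 \<le> 1" using cx by (simp add: abs_square_le_1)
    ultimately show ?thesis unfolding y2 n_def by simp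
  qed
  have y4_le: "bernstein_mean m x (\<lambda>k. y k ^ 4) \<le> 32 * n\<^sup>2"
    unfolding y_def n_def by (rule bernstein_mean_shift4_le[OF x cx])
  have "(\<lambda>k. f (t k)) = (\<lambda>k. f x + (b / n * y k + (d / 2 / n\<^sup>2 * (y k)\<^sup>2 + R k)))"
    by (simp add: R_def ty power_divide)
  then have mean: "bernstein_mean m x (\<lambda>k. f (t k)) =
      f x + (b / n * (c - x) + (d / 2 / n\<^sup>2 * (real m * (x * (1 - x)) + (c - x)\<^sup>2) + bernstein_mean m x R))"
    by (simp only: bernstein_mean_add bernstein_mean_cmult bernstein_mean_const y1 y2)
  \<comment> \<open>Applied with \<open>u\<close> the first moment, \<open>w\<close> the second
    moment and \<open>v\<close> the mean of \<open>R\<close>: the main terms cancel and only the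
    remainder is left.\<close>
  have "n * (f x + (b / n * u + (d / 2 / n\<^sup>2 * w + v)) - f x) - (b * u + d / 2 * (w / n)) = n * v"
    for u v w
    using n by (simp add: field_simps power2_eq_square)
  then have "n * (bernstein_mean m x (\<lambda>k. f (t k)) - f x) -
      (b * (c - x) + d / 2 * ((real m * (x * (1 - x)) + (c - x)\<^sup>2) / n)) = n * bernstein_mean m x R"
    unfolding mean .
  moreover have "\<bar>n * bernstein_mean m x R\<bar> \<le> 2 * e + 32 * K / n"
  proof -
    have "\<bar>bernstein_mean m x R\<bar> \<le> bernstein_mean m x (\<lambda>k. \<bar>R k\<bar>)"
      by (rule abs_bernstein_mean_le[OF x])
    also have "\<dots> \<le> bernstein_mean m x (\<lambda>k. e / n\<^sup>2 * (y k)\<^sup>2 + K / n ^ 4 * y k ^ 4)"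
    proof (rule bernstein_mean_mono[OF x])
      fix k assume "k \<le> m"
      from bound[OF t01[OF this]] show "\<bar>R k\<bar> \<le> e / n\<^sup>2 * (y k)\<^sup>2 + K / n ^ 4 * y k ^ 4"
        unfolding R_def ty by (simp add: power_divide)
    qed
    also have "\<dots> = e / n\<^sup>2 * bernstein_mean m x (\<lambda>k. (y k)\<^sup>2) + K / n ^ 4 * bernstein_mean m x (\<lambda>k. y k ^ 4)"
      by (simp only: bernstein_mean_add bernstein_mean_cmult)
    also have "\<dots> \<le> e / n\<^sup>2 * (2 * n) + K / n ^ 4 * (32 * n\<^sup>2)"
      using y2_le y4_le e K by (intro add_mono mult_left_mono) auto
    also have "\<dots> = (2 * e + 32 * K / n) / n"
      using n by (simp add: field_simps power2_eq_square power4_eq_xxxx)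
    finally show ?thesis using n by (simp add: abs_mult field_simps)
  qed
  ultimately show ?thesis by (simp add: t_def)
qed

section \<open>Passage to the limit\<close>

theorem proposition4p1:
  fixes a0 a1 :: "nat \<Rightarrow> real" and f f' f'' :: "real \<Rightarrow> real" and x L1 :: real
  assumes norm_cond: "\<And>n. n \<ge> 1 \<Longrightarrow> 2 * a0 n + a1 n = 1"
    and f_deriv: "\<And>t. t \<in> {0..1} \<Longrightarrow> (f has_real_derivative f' t) (at t within {0..1})"
    and f'_deriv: "\<And>t. t \<in> {0..1} \<Longrightarrow> (f' has_real_derivative f'' t) (at t within {0..1})"
    and f''_cont: "continuous_on {0..1} f''"
    and x: "x \<in> {0..1}"
    and a1_lim: "a1 \<longlonglongrightarrow> L1"
  shows "(\<lambda>n. real n * (mod_bernstein_op a0 a1 n f x - f x))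
           \<longlonglongrightarrow> x * (1 - x) / 2 * f'' x + (1 - 2 * x) / 2 * (1 + L1) * f' x"
proof -
  define q where "q = x * (1 - x)"
  define A C where "A m = mod_coeff a0 a1 x (Suc m)" and "C m = mod_coeff a0 a1 (1 - x) (Suc m)" for m
  \<comment> \<open>\<open>P c\<close> is the main term for the nodes with offset \<open>c\<close>,
    and \<open>D c\<close> is the error.\<close>
  define P where "P c m = f' x * (c - x) + f'' x / 2 * ((real m * q + (c - x)\<^sup>2) / real (Suc m))"
    for c m
  define D where "D c m = real (Suc m) * (bernstein_mean m x (\<lambda>k. f ((real k + c) / real (Suc m))) - f x) - P c m"
    for c m
  have D_lim: "D c \<longlonglongrightarrow> 0" if c: "c \<in> {0..1}" for c
  proof (rule LIMSEQ_I)
    fix r :: real assume "r > 0"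
    \<comment> \<open>With e = r / 4 the quadratic part costs r / 2. \<open>K\<close> is fixed
      before \<open>m\<close>, so the quartic part falls below r / 2 for large
      \<open>m\<close>.\<close>
    then obtain K where K: "K \<ge> 0" "\<And>t. t \<in> {0..1} \<Longrightarrow>
       \<bar>f t - (f x + f' x * (t - x) + f'' x / 2 * (t - x)\<^sup>2)\<bar> \<le> r / 4 * (t - x)\<^sup>2 + K * (t - x) ^ 4"
      using peano_remainder[OF f_deriv f'_deriv[OF x] x, of "r / 4"] by auto
    have D_le: "\<bar>D c m\<bar> \<le> 2 * (r / 4) + 32 * K / real (Suc m)" for m
      unfolding D_def P_def q_def
      by (rule bernstein_mean_taylor[OF x c _ K]) (use \<open>r > 0\<close> in auto)
    have "(\<lambda>m. 32 * K / real (Suc m)) \<longlonglongrightarrow> 0"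
      by (intro LIMSEQ_Suc lim_const_over_n)
    then have "\<forall>\<^sub>F m in sequentially. 32 * K / real (Suc m) < r / 2"
      by (rule order_tendstoD) (use \<open>r > 0\<close> in simp)
    then have "\<forall>\<^sub>F m in sequentially. norm (D c m - 0) < r"
    proof eventually_elim
      case (elim m)
      then show ?case using D_le[of m] by simp
    qed
    then show "\<exists>N. \<forall>m\<ge>N. norm (D c m - 0) < r"
      by (simp add: eventually_sequentially)
  qed
  have P_lim: "P c \<longlonglongrightarrow> f' x * (c - x) + f'' x / 2 * q" for c
  proof -
    have "(\<lambda>m. q + ((c - x)\<^sup>2 - q) / real (Suc m)) \<longlonglongrightarrow> q + 0"
      by (intro tendsto_add tendsto_const LIMSEQ_Suc lim_const_over_n)
    moreover have "q + ((c - x)\<^sup>2 - q) / real (Suc m) = (real m * q + (c - x)\<^sup>2) / real (Suc m)" for m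
      by (simp add: field_simps)
    ultimately have "(\<lambda>m. (real m * q + (c - x)\<^sup>2) / real (Suc m)) \<longlonglongrightarrow> q"
      by simp
    then show ?thesis
      unfolding P_def by (intro tendsto_intros)
  qed
  have a0: "a0 (Suc m) = (1 - a1 (Suc m)) / 2" for m
    using norm_cond[of "Suc m"] by simp
  \<comment> \<open>This identity lets \<open>f x\<close> be distributed over the two parts of the
    operator.\<close>
  have AC: "A m + C m = 1" for m
    by (simp add: A_def C_def mod_coeff_def a0 field_simps)
  have a1': "(\<lambda>m. a1 (Suc m)) \<longlonglongrightarrow> L1" using a1_lim by (rule LIMSEQ_Suc)
  \<comment> \<open>The weights may have any sign; as they converge, their products with the errors
    \<open>D 0\<close> and \<open>D 1\<close> still tend to 0.\<close>
  have A_lim: "A \<longlonglongrightarrow> L1 * x + (1 - L1) / 2"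
    unfolding A_def mod_coeff_def a0 by (intro tendsto_intros a1') simp
  have C_lim: "C \<longlonglongrightarrow> L1 * (1 - x) + (1 - L1) / 2"
    unfolding C_def mod_coeff_def a0 by (intro tendsto_intros a1') simp
  have split: "real (Suc m) * (mod_bernstein_op a0 a1 (Suc m) f x - f x) =
      A m * (P 0 m + D 0 m) + C m * (P 1 m + D 1 m)" for m
  proof -
    define E0 E1 where "E0 = bernstein_mean m x (\<lambda>k. f (real k / real (Suc m)))"
      and "E1 = bernstein_mean m x (\<lambda>k. f (real (Suc k) / real (Suc m)))"
    have "mod_bernstein_op a0 a1 (Suc m) f x - f x = A m * E0 + C m * E1 - (A m + C m) * f x"
      by (simp only: AC mod_bernstein_op_Suc A_def[symmetric] C_def[symmetric] E0_def E1_def mult_1)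
    also have "\<dots> = A m * (E0 - f x) + C m * (E1 - f x)"
      by (simp add: algebra_simps)
    finally have "real (Suc m) * (mod_bernstein_op a0 a1 (Suc m) f x - f x) =
        A m * (real (Suc m) * (E0 - f x)) + C m * (real (Suc m) * (E1 - f x))"
      by (simp only: distrib_left mult.left_commute)
    then show ?thesis
      by (simp add: D_def E0_def E1_def add.commute)
  qed
  have "(\<lambda>m. A m * (P 0 m + D 0 m) + C m * (P 1 m + D 1 m)) \<longlonglongrightarrow>
      (L1 * x + (1 - L1) / 2) * (f' x * (0 - x) + f'' x / 2 * q + 0) +
      (L1 * (1 - x) + (1 - L1) / 2) * (f' x * (1 - x) + f'' x / 2 * q + 0)"
    by (intro tendsto_intros A_lim C_lim P_lim D_lim) auto
  \<comment> \<open>The limit weights have sum 1, which settles the \<open>f'' x\<close> terms. The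
    coefficient of \<open>f' x\<close> is L1 ((1 - x)^2 - x^2) + (1 - L1) (1 - 2 x) / 2 = (1 - 2 x)
    (1 + L1) / 2.\<close>
  also have "(L1 * x + (1 - L1) / 2) * (f' x * (0 - x) + f'' x / 2 * q + 0) +
      (L1 * (1 - x) + (1 - L1) / 2) * (f' x * (1 - x) + f'' x / 2 * q + 0) =
      x * (1 - x) / 2 * f'' x + (1 - 2 * x) / 2 * (1 + L1) * f' x"
    by (simp add: q_def field_simps)
  finally have "(\<lambda>m. real (Suc m) * (mod_bernstein_op a0 a1 (Suc m) f x - f x))
      \<longlonglongrightarrow> x * (1 - x) / 2 * f'' x + (1 - 2 * x) / 2 * (1 + L1) * f' x"
    unfolding split .
  \<comment> \<open>Shifting the index back is harmless, since the value at n = 0 does not affect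
    the limit.\<close>
  then show ?thesis by (rule LIMSEQ_imp_Suc)
qed

end
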